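(* Let $\operatorname{dom}\Gamma$ be closed, and let $\Gamma$ be locally bounded and lower semicontinuous w.r.t. its domain at each point from $\operatorname{dom}\Gamma$. Let $\operatorname{gph}\Psi_{\mathrm w}\cap(X\times\mathbb R^m)$ be nonempty and bounded. Then there exist an efficient and a weakly efficient point of the problem $$\min_{x,y}{}_{\mathcal K}\{F(x,y)\mid x\in X,\ y\in\Psi_{\mathrm w}(x)\}.$$
   Context: Setting: $F\colon\mathbb R^n\times\mathbb R^m\to\mathbb R^p$ is continuous, $\mathcal K\subset\mathbb R^p$ is a nonempty, closed, convex, pointed cone with nonempty interior, $X\subset\mathbb R^n$ is nonempty and closed, $f\colon\mathbb R^n\times\mathbb R^m\to\mathbb R^q$ is continuous, $\mathcal C\subset\mathbb R^q$ is a nonempty, closed, convex, pointed cone with nonempty interior, and $\Gamma\colon\mathbb R^n\rightrightarrows\mathbb R^m$ is a set-valued mapping (values may be empty) with closed graph. For $x\in\mathbb R^n$, with $f(x,A):=\{f(x,y)\mid y\in A\}$, $\Psi_{\mathrm w}(x):=\{y\in\Gamma(x)\mid (\{f(x,y)\}-\operatorname{int}\mathcal C)\cap f(x,\Gamma(x))=\emptyset\}$. With feasible set $S:=\{(x,y)\mid x\in X,\ y\in\Psi_{\mathrm w}(x)\}$, a point $(\bar x,\bar y)\in S$ is efficient if $(\{F(\bar x,\bar y)\}-\mathcal K\setminus\{0\})\cap F(S)=\emptyset$, and weakly efficient if $(\{F(\bar x,\bar y)\}-\operatorname{int}\mathcal K)\cap F(S)=\emptyset$. For a set-valued mapping $\Upsilon\colon\mathbb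 R^n\rightrightarrows\mathbb R^\ell$: $\operatorname{gph}\Upsilon:=\{(x,y)\mid y\in\Upsilon(x)\}$, $\operatorname{dom}\Upsilon:=\{x\mid\Upsilon(x)\neq\emptyset\}$. For $\bar x\in\operatorname{dom}\Upsilon$: $\Upsilon$ is locally bounded at $\bar x$ if there are a bounded set $B$ and a neighborhood $U$ of $\bar x$ with $\Upsilon(x)\subset B$ for all $x\in U$; $\Upsilon$ is lower semicontinuous at $\bar x$ w.r.t. $\Omega\subset\mathbb R^n$ if for each open set $V$ with $\Upsilon(\bar x)\cap V\neq\emptyset$ there is a neighborhood $U$ of $\bar x$ such that $\Upsilon(x)\cap V\neq\emptyset$ for all $x\in\Omega\cap U$. *)

theory Defs
  imports "HOL-Analysis.Analysis"
begin

text \<open>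
  A set-valued mapping is a function into sets, and its values may be empty.
  The single-valued data of the problem are functions on the product space.
\<close>

definition gph :: "('a \<Rightarrow> 'b set) \<Rightarrow> ('a \<times> 'b) set" where
  "gph \<Upsilon> = {(x, y). y \<in> \<Upsilon> x}"

definition sv_dom :: "('a \<Rightarrow> 'b set) \<Rightarrow> 'a set" where
  "sv_dom \<Upsilon> = {x. \<Upsilon> x \<noteq> {}}"

definition locally_bounded_at ::
    "('a::topological_space \<Rightarrow> 'b::metric_space set) \<Rightarrow> 'a \<Rightarrow> bool" where
  "locally_bounded_at \<Upsilon> xb \<longleftrightarrow>
     (\<exists>B U. bounded B \<and> open U \<and> xb \<in> U \<and> (\<forall>x\<in>U. \<Upsilon> x \<subseteq> B))"

definition lsc_at_wrt ::
    "('a::topological_space \<Rightarrow> 'b::topological_space set) \<Rightarrow> 'a \<Rightarrow> 'a set \<Rightarrow> bool" where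
  "lsc_at_wrt \<Upsilon> xb \<Omega> \<longleftrightarrow>
     (\<forall>V. open V \<and> \<Upsilon> xb \<inter> V \<noteq> {} \<longrightarrow>
       (\<exists>U. open U \<and> xb \<in> U \<and> (\<forall>x \<in> \<Omega> \<inter> U. \<Upsilon> x \<inter> V \<noteq> {})))"

text \<open>
  The library predicate \<^const>\<open>cone\<close> asks for closedness under multiplication by all
  scalars \<open>c \<ge> 0\<close>; for nonempty closed sets, asking only for \<open>c > 0\<close> is the same.
\<close>

definition ordering_cone :: "'a::real_normed_vector set \<Rightarrow> bool" where
  "ordering_cone K \<longleftrightarrow>
     K \<noteq> {} \<and> closed K \<and> convex K \<and> cone K \<and> K \<inter> uminus ` K = {0} \<and> interior K \<noteq> {}"

definition Psi_w ::
    "('a \<times> 'b \<Rightarrow> 'c::real_normed_vector) \<Rightarrow> 'c set \<Rightarrow> ('a \<Rightarrow> 'b set) \<Rightarrow> 'a \<Rightarrow> 'b set" where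
  "Psi_w f C \<Gamma> x =
     {y \<in> \<Gamma> x. (\<lambda>c. f (x, y) - c) ` interior C \<inter> (\<lambda>y'. f (x, y')) ` \<Gamma> x = {}}"

definition feasible_set ::
    "'a set \<Rightarrow> ('a \<times> 'b \<Rightarrow> 'c::real_normed_vector) \<Rightarrow> 'c set \<Rightarrow> ('a \<Rightarrow> 'b set) \<Rightarrow> ('a \<times> 'b) set" where
  "feasible_set X f C \<Gamma> = {(x, y). x \<in> X \<and> y \<in> Psi_w f C \<Gamma> x}"

definition efficient ::
    "('z \<Rightarrow> 'c::real_normed_vector) \<Rightarrow> 'c set \<Rightarrow> 'z set \<Rightarrow> 'z \<Rightarrow> bool" where
  "efficient F K S z \<longleftrightarrow> z \<in> S \<and> (\<lambda>k. F z - k) ` (K - {0}) \<inter> F ` S = {}"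

definition weakly_efficient ::
    "('z \<Rightarrow> 'c::real_normed_vector) \<Rightarrow> 'c set \<Rightarrow> 'z set \<Rightarrow> 'z \<Rightarrow> bool" where
  "weakly_efficient F K S z \<longleftrightarrow> z \<in> S \<and> (\<lambda>k. F z - k) ` interior K \<inter> F ` S = {}"

end

theory Submission
  imports Defs
begin

text \<open>
  The weakly efficient graph is closed because a strict improvement persists nearby: lower
  semicontinuity of \<open>\<Gamma>\<close> supplies competitors close to a given one. So the feasible set is compact.
  A closed convex pointed cone in finite dimension admits a linear functional that is positive on
  its nonzero elements, and minimising that functional of \<open>F\<close> over the feasible set yields an
  efficient point, which is then also weakly efficient.
\<close>

lemma closed_gph_Psi_w:
  fixes f :: "'a::topological_space \<times> 'b::topological_space \<Rightarrow> 'c::real_normed_vector"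
  assumes f: "continuous_on UNIV f"
    and \<Gamma>: "closed (gph \<Gamma>)"
    and lsc: "\<And>x. x \<in> sv_dom \<Gamma> \<Longrightarrow> lsc_at_wrt \<Gamma> x (sv_dom \<Gamma>)"
  shows "closed (gph (Psi_w f C \<Gamma>))"
proof -
  have "\<exists>T. open T \<and> p \<in> T \<and> T \<subseteq> - gph (Psi_w f C \<Gamma>)" if p: "p \<notin> gph (Psi_w f C \<Gamma>)" for p
  proof (cases "p \<in> gph \<Gamma>")
    case False
    have "open (- gph \<Gamma>)" "- gph \<Gamma> \<subseteq> - gph (Psi_w f C \<Gamma>)"
      using \<Gamma> by (auto simp: gph_def Psi_w_def)
    with False show ?thesis by blast
  next
    case True
    obtain x y where xy: "p = (x, y)" by fastforce
    then have y: "y \<in> \<Gamma> x" using True by (simp add: gph_def)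
    \<comment> \<open>As \<open>y\<close> lies in \<open>\<Gamma> x\<close> but is not weakly
      efficient there, some competitor \<open>y'\<close> improves on it by a vector \<open>c\<close>
      of the interior of \<open>C\<close>.\<close>
    obtain y' c where y': "y' \<in> \<Gamma> x" "c \<in> interior C" "f (x, y) - c = f (x, y')"
      using p y unfolding xy gph_def Psi_w_def by blast
    \<comment> \<open>\<open>g\<close> sends a point \<open>(x, y)\<close> and a competitor
      \<open>y'\<close> to the improvement \<open>f (x, y) - f (x, y')\<close>. Being a strict
      improvement is thus an open condition on \<open>((x, y), y')\<close>, which yields the box
      \<open>P \<times> W\<close>.\<close>
    define g where "g = (\<lambda>(q, b). f q - f (fst q, b))"
    have "continuous_on UNIV g"
      unfolding g_def case_prod_beta
      by (intro continuous_intros continuous_on_compose2[OF f]) auto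
    then have "open (g -` interior C)"
      by (simp add: open_vimage)
    moreover have "((x, y), y') \<in> g -` interior C"
      using y' by (simp add: g_def algebra_simps)
    ultimately obtain P W where P: "open P" "(x, y) \<in> P" and W: "open W" "y' \<in> W"
      and PW: "P \<times> W \<subseteq> g -` interior C"
      by (rule open_prod_elim) blast
    have x: "x \<in> sv_dom \<Gamma>" using y by (auto simp: sv_dom_def)
    have "\<Gamma> x \<inter> W \<noteq> {}" using y' W by blast
    then obtain U where U: "open U" "x \<in> U" and UW: "\<And>u. u \<in> sv_dom \<Gamma> \<inter> U \<Longrightarrow> \<Gamma> u \<inter> W \<noteq> {}"
      using lsc[OF x] W unfolding lsc_at_wrt_def by meson
    \<comment> \<open>If \<open>v\<close> lies in \<open>\<Gamma> u\<close>, then \<open>u\<close>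
      is in the domain, so semicontinuity relative to the domain puts some \<open>w\<close> of
      \<open>\<Gamma> u\<close> into \<open>W\<close>; this \<open>w\<close> strictly improves on
      \<open>v\<close>.\<close>
    have "(u, v) \<notin> gph (Psi_w f C \<Gamma>)" if uv: "(u, v) \<in> P \<inter> U \<times> UNIV" for u v
    proof
      assume "(u, v) \<in> gph (Psi_w f C \<Gamma>)"
      then have v: "v \<in> \<Gamma> u"
        and no: "(\<lambda>c. f (u, v) - c) ` interior C \<inter> (\<lambda>y'. f (u, y')) ` \<Gamma> u = {}"
        by (auto simp: gph_def Psi_w_def)
      obtain w where w: "w \<in> \<Gamma> u" "w \<in> W"
        using UW[of u] uv v by (auto simp: sv_dom_def)
      then have "f (u, v) - f (u, w) \<in> interior C"
        using PW uv by (auto simp: g_def)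
      then have "f (u, v) - (f (u, v) - f (u, w)) \<in> (\<lambda>c. f (u, v) - c) ` interior C"
        by (rule imageI)
      with no w show False by auto
    qed
    then have "P \<inter> U \<times> UNIV \<subseteq> - gph (Psi_w f C \<Gamma>)"
      by auto
    moreover have "open (P \<inter> U \<times> UNIV)" "p \<in> P \<inter> U \<times> UNIV"
      using P U by (auto simp: xy intro: open_Times)
    ultimately show ?thesis by blast
  qed
  then show ?thesis
    unfolding closed_def by (subst open_subopen) blast
qed

text \<open>If a convex combination of two nonzero elements vanished, one scaled summand would be
  the negative of the other, hence zero by pointedness, and both weights would be zero.\<close>

lemma pointed_cone_minus_zero_convex:
  fixes K :: "'a::real_vector set"
  assumes "convex K" "cone K" "K \<inter> uminus ` K = {0}"
  shows "convex (K - {0})"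
proof (rule convexI)
  fix x y :: 'a and u v :: real
  assume xy: "x \<in> K - {0}" "y \<in> K - {0}" and uv: "0 \<le> u" "0 \<le> v" "u + v = 1"
  have "u *\<^sub>R x + v *\<^sub>R y \<in> K"
    using assms(1) xy uv by (auto intro: convexD)
  moreover have "u *\<^sub>R x + v *\<^sub>R y \<noteq> 0"
  proof
    assume 0: "u *\<^sub>R x + v *\<^sub>R y = 0"
    then have "u *\<^sub>R x = - (v *\<^sub>R y)"
      by (simp add: eq_neg_iff_add_eq_0)
    moreover have "u *\<^sub>R x \<in> K" "v *\<^sub>R y \<in> K"
      using assms(2) xy uv by (auto simp: cone_def)
    ultimately have "u *\<^sub>R x = 0"
      using assms(3) by (metis IntI imageI singletonD)
    with 0 have "u = 0" "v = 0"
      using xy by auto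
    with uv show False by simp
  qed
  ultimately show "u *\<^sub>R x + v *\<^sub>R y \<in> K - {0}" by simp
qed

text \<open>The unit vectors of \<open>K\<close> form a compact set, so their convex hull is compact
  too. Strictly separating it from 0 gives \<open>w\<close>, and scaling carries positivity to all
  nonzero elements of \<open>K\<close>.\<close>

lemma pointed_cone_positive_functional:
  fixes K :: "'a::euclidean_space set"
  assumes "closed K" "convex K" "cone K" "K \<inter> uminus ` K = {0}"
  obtains w where "\<And>k. k \<in> K - {0} \<Longrightarrow> w \<bullet> k > 0"
proof -
  define B where "B = convex hull (K \<inter> sphere 0 1)"
  have "compact B"
    unfolding B_def using assms(1) by (intro compact_convex_hull closed_Int_compact) auto
  moreover have "convex B"
    by (simp add: B_def)
  \<comment> \<open>Here pointedness enters: \<open>K - {0}\<close> is itself convex, so taking the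
    hull cannot pick up 0.\<close>
  moreover have "B \<subseteq> K - {0}"
    unfolding B_def using pointed_cone_minus_zero_convex[OF assms(2-4)]
    by (intro hull_minimal) auto
  ultimately obtain w b where w: "0 < b" "\<forall>x\<in>B. w \<bullet> x > b"
    using separating_hyperplane_closed_0[of B] compact_imp_closed by blast
  have "w \<bullet> k > 0" if k: "k \<in> K - {0}" for k
  proof -
    have "k /\<^sub>R norm k \<in> K \<inter> sphere 0 1"
      using assms(3) k by (auto simp: cone_def)
    then have "k /\<^sub>R norm k \<in> B"
      by (simp add: B_def hull_inc)
    then have "0 < w \<bullet> (k /\<^sub>R norm k)"
      using w by force
    then show ?thesis
      using k by (simp add: zero_less_mult_iff)
  qed
  then show ?thesis by (rule that)
qed

text \<open>A ball around 0 inside \<open>K\<close> would contain two opposite nonzero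
  vectors.\<close>

lemma zero_notin_interior_pointed_cone:
  fixes K :: "'a::euclidean_space set"
  assumes "K \<inter> uminus ` K = {0}"
  shows "0 \<notin> interior K"
proof
  assume "0 \<in> interior K"
  then obtain e where e: "e > 0" "cball 0 e \<subseteq> K"
    by (auto simp: mem_interior_cball)
  obtain b :: 'a where b: "b \<in> Basis" using nonempty_Basis by blast
  have "e *\<^sub>R b \<in> K" "- (e *\<^sub>R b) \<in> K"
    using e b by auto
  then have "e *\<^sub>R b = 0"
    using assms by (metis IntI imageI minus_minus singletonD)
  with e b show False by auto
qed

lemma efficient_imp_weakly_efficient:
  fixes K :: "'a::euclidean_space set"
  assumes "ordering_cone K" "efficient F K S z"
  shows "weakly_efficient F K S z"
proof -
  have "interior K \<subseteq> K - {0}"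
    using assms(1) zero_notin_interior_pointed_cone[of K] interior_subset[of K]
    by (auto simp: ordering_cone_def)
  then show ?thesis
    using assms(2) unfolding efficient_def weakly_efficient_def by blast
qed

text \<open>Scalarisation: a feasible value \<open>F z - k\<close> with nonzero \<open>k\<close> in
  \<open>K\<close> would lower the positive functional by \<open>w \<bullet> k\<close>, so a
  minimiser of \<open>w \<bullet> F z\<close> over the compact set is efficient.\<close>

lemma efficient_point_exists:
  fixes F :: "'z::topological_space \<Rightarrow> 'a::euclidean_space"
  assumes K: "ordering_cone K" and "compact S" "S \<noteq> {}" "continuous_on S F"
  obtains z where "efficient F K S z"
proof -
  obtain w where w: "\<And>k. k \<in> K - {0} \<Longrightarrow> w \<bullet> k > 0"
    using K pointed_cone_positive_functional[of K] by (auto simp: ordering_cone_def)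
  have "continuous_on S (\<lambda>z. w \<bullet> F z)"
    using assms by (intro continuous_intros)
  then obtain z where z: "z \<in> S" "\<And>s. s \<in> S \<Longrightarrow> w \<bullet> F z \<le> w \<bullet> F s"
    using continuous_attains_inf assms(2,3) by metis
  have "F z - k \<noteq> F s" if "k \<in> K - {0}" "s \<in> S" for k s
    using w[OF that(1)] z(2)[OF that(2)] by (auto simp: inner_diff_right dest!: arg_cong[of _ _ "inner w"])
  then have "efficient F K S z"
    using z(1) unfolding efficient_def by blast
  then show ?thesis by (rule that)
qed

theorem corollary3p15:
  fixes F :: "(real ^ 'n) \<times> (real ^ 'm) \<Rightarrow> real ^ 'p"
    and K :: "(real ^ 'p) set"
    and X :: "(real ^ 'n) set"
    and f :: "(real ^ 'n) \<times> (real ^ 'm) \<Rightarrow> real ^ 'q"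
    and C :: "(real ^ 'q) set"
    and \<Gamma> :: "real ^ 'n \<Rightarrow> (real ^ 'm) set"
  assumes "continuous_on UNIV F"
    and "ordering_cone K"
    and "X \<noteq> {}" and "closed X"
    and "continuous_on UNIV f"
    and "ordering_cone C"
    and "closed (gph \<Gamma>)"
    and "closed (sv_dom \<Gamma>)"
    and "\<And>x. x \<in> sv_dom \<Gamma> \<Longrightarrow> locally_bounded_at \<Gamma> x"
    and "\<And>x. x \<in> sv_dom \<Gamma> \<Longrightarrow> lsc_at_wrt \<Gamma> x (sv_dom \<Gamma>)"
    and "gph (Psi_w f C \<Gamma>) \<inter> (X \<times> UNIV) \<noteq> {}"
    and "bounded (gph (Psi_w f C \<Gamma>) \<inter> (X \<times> UNIV))"
  shows "(\<exists>z. efficient F K (feasible_set X f C \<Gamma>) z) \<and>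
         (\<exists>z. weakly_efficient F K (feasible_set X f C \<Gamma>) z)"
proof -
  let ?S = "feasible_set X f C \<Gamma>"
  have S: "?S = gph (Psi_w f C \<Gamma>) \<inter> (X \<times> UNIV)"
    by (auto simp: feasible_set_def gph_def)
  have "closed (gph (Psi_w f C \<Gamma>))"
    using assms(5,7,10) by (rule closed_gph_Psi_w)
  \<comment> \<open>Closedness of \<open>X\<close> passes from the whole graph to its part over
    \<open>X\<close>; with boundedness this gives compactness.\<close>
  then have "closed ?S"
    unfolding S using assms(4) by (intro closed_Int closed_Times) auto
  then have "compact ?S"
    using assms(12) by (simp add: S compact_eq_bounded_closed)
  moreover have "?S \<noteq> {}"
    using assms(11) by (simp add: S)
  moreover have "continuous_on ?S F"
    using assms(1) continuous_on_subset by blast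
  ultimately obtain z where z: "efficient F K ?S z"
    using efficient_point_exists[OF assms(2)] by metis
  show ?thesis
    using z efficient_imp_weakly_efficient[OF assms(2) z] by (intro conjI exI[of _ z])
qed

end
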